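(* Let $(G,\omega,\mu)$ be an infinite, connected, locally finite weighted graph, let $\Omega\subset G$ be a nonempty finite subset, and let $f:G\to\mathbb{R}$. Assume that for some $k_0>0$ $$0\le \mathfrak{D}_+(x)\le k_0\quad\text{for all }x\in G\text{ with }\rho(x,\Omega)\ge 1,$$ where $\mathfrak{D}_+$ is the outer degree with respect to $\Omega$, and that $V:G\to\mathbb{R}$ satisfies, for some $\alpha\in[0,1]$ and $c_0>0$, $$V(x)\ge c_0\,[1+\rho(x,\Omega)]^{-\alpha}\quad\text{for all }x\in G .$$ Then there exists at most one solution $u:G\to\mathbb{R}$ of $\Delta u-Vu=f$ in $G$ such that $$\lim_{\rho(x,\Omega)\to+\infty}\frac{u(x)}{\tilde Z(x)}=0,$$ where, whenever $\rho(x,\Omega)>1$, $\tilde Z(x):=-[\rho(x,\Omega)]^{1-\alpha}$ if $\alpha\in[0,1)$ and $\tilde Z(x):=-\log\rho(x,\Omega)$ if $\alpha=1$.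
   Context: A weighted graph is a triplet $(G,\omega,\mu)$ where $G$ is a countably infinite set, $\mu:G\to(0,+\infty)$ is the node measure, and $\omega:G\times G\to[0,+\infty)$ is the edge weight, satisfying $\omega(x,y)=\omega(y,x)$, $\omega(x,x)=0$ and $\sum_{y\in G}\omega(x,y)<\infty$ for all $x,y\in G$. Write $x\sim y$ if $\omega(x,y)>0$. A path is a finite sequence $x_0,\dots,x_n$ with $x_k\sim x_{k+1}$ for all $k$. The graph is connected if any two distinct vertices are joined by a path, and locally finite if every $x\in G$ has only finitely many $y$ with $x\sim y$. The combinatorial distance $\rho(x,y)$ is the least number of edges in a path between $x$ and $y$; $\rho(x,\Omega)=\min_{y\in\Omega}\rho(x,y)$; $S_r(\Omega)=\{x\in G:\rho(x,\Omega)=r\}$ for integers $r\ge0$. For $x\in G$ with $r=\rho(x,\Omega)\ge1$, the outer degree with respect to $\Omega$ is $\mathfrak{D}_+(x)=\frac1{\mu(x)}\sum_{y\in S_{r+1}(\Omega)}\omega(x,y)$. The Laplace operator is $\Delta f(x)=\frac1{\mu(x)}\sum_{y\in G}[f(y)-f(x)]\,\omega(x,y)$ for $f:G\to\mathbb{R}$, $x\in G$. A function $u:G\to\mathbb{R}$ is a solution of $\Delta u-Vu=f$ in $G$ if $\Delta u(x)-V(x)u(x)=f(x)$ for every $x\in G$. *)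

theory Defs
  imports "HOL-Analysis.Infinite_Sum" "HOL-Library.Countable_Set"
begin

text \<open>
  The vertex set is a type \<open>'a\<close>, required to be countably infinite. A weighted graph is given by
  its edge weight \<open>\<omega>\<close> and its node measure \<open>\<mu>\<close>.
\<close>

locale weighted_graph =
  fixes \<omega> :: "'a \<Rightarrow> 'a \<Rightarrow> real" and \<mu> :: "'a \<Rightarrow> real"
  assumes countable_vertices: "countable (UNIV :: 'a set)"
    and infinite_vertices: "infinite (UNIV :: 'a set)"
    and measure_pos: "\<mu> x > 0"
    and weight_nonneg: "\<omega> x y \<ge> 0"
    and weight_sym: "\<omega> x y = \<omega> y x"
    and weight_irrefl: "\<omega> x x = 0"
    and weight_summable: "(\<lambda>y. \<omega> x y) summable_on UNIV"

definition adjacent :: "('a \<Rightarrow> 'a \<Rightarrow> real) \<Rightarrow> 'a \<Rightarrow> 'a \<Rightarrow> bool" where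
  "adjacent \<omega> x y \<longleftrightarrow> \<omega> x y > 0"

definition path_between :: "('a \<Rightarrow> 'a \<Rightarrow> real) \<Rightarrow> 'a \<Rightarrow> 'a list \<Rightarrow> 'a \<Rightarrow> bool" where
  "path_between \<omega> x p y \<longleftrightarrow>
     p \<noteq> [] \<and> hd p = x \<and> last p = y \<and> successively (adjacent \<omega>) p"

definition graph_connected :: "('a \<Rightarrow> 'a \<Rightarrow> real) \<Rightarrow> bool" where
  "graph_connected \<omega> \<longleftrightarrow> (\<forall>x y. x \<noteq> y \<longrightarrow> (\<exists>p. path_between \<omega> x p y))"

definition locally_finite :: "('a \<Rightarrow> 'a \<Rightarrow> real) \<Rightarrow> bool" where
  "locally_finite \<omega> \<longleftrightarrow> (\<forall>x. finite {y. adjacent \<omega> x y})"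

text \<open>
  A path with vertices \<open>p\<close> has \<open>length p - 1\<close> edges. The value of \<open>comb_dist \<omega> x y\<close> is meaningful
  only if \<open>x\<close> and \<open>y\<close> are joined by a path.
\<close>

definition comb_dist :: "('a \<Rightarrow> 'a \<Rightarrow> real) \<Rightarrow> 'a \<Rightarrow> 'a \<Rightarrow> nat" where
  "comb_dist \<omega> x y = (LEAST n. \<exists>p. path_between \<omega> x p y \<and> length p = Suc n)"

text \<open>An infimum of a nonempty set of naturals is attained, so this is a minimum for \<open>\<Omega> \<noteq> {}\<close>.\<close>

definition set_dist :: "('a \<Rightarrow> 'a \<Rightarrow> real) \<Rightarrow> 'a \<Rightarrow> 'a set \<Rightarrow> nat" where
  "set_dist \<omega> x \<Omega> = (INF y\<in>\<Omega>. comb_dist \<omega> x y)"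

definition set_sphere :: "('a \<Rightarrow> 'a \<Rightarrow> real) \<Rightarrow> nat \<Rightarrow> 'a set \<Rightarrow> 'a set" where
  "set_sphere \<omega> r \<Omega> = {x. set_dist \<omega> x \<Omega> = r}"

definition outer_degree ::
  "('a \<Rightarrow> 'a \<Rightarrow> real) \<Rightarrow> ('a \<Rightarrow> real) \<Rightarrow> 'a set \<Rightarrow> 'a \<Rightarrow> real" where
  "outer_degree \<omega> \<mu> \<Omega> x =
     1 / \<mu> x * (\<Sum>\<^sub>\<infinity>y\<in>set_sphere \<omega> (set_dist \<omega> x \<Omega> + 1) \<Omega>. \<omega> x y)"

definition laplacian ::
  "('a \<Rightarrow> 'a \<Rightarrow> real) \<Rightarrow> ('a \<Rightarrow> real) \<Rightarrow> ('a \<Rightarrow> real) \<Rightarrow> 'a \<Rightarrow> real" where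
  "laplacian \<omega> \<mu> f x = 1 / \<mu> x * (\<Sum>\<^sub>\<infinity>y. (f y - f x) * \<omega> x y)"

definition is_solution ::
  "('a \<Rightarrow> 'a \<Rightarrow> real) \<Rightarrow> ('a \<Rightarrow> real) \<Rightarrow> ('a \<Rightarrow> real) \<Rightarrow> ('a \<Rightarrow> real) \<Rightarrow> ('a \<Rightarrow> real) \<Rightarrow> bool" where
  "is_solution \<omega> \<mu> V f u \<longleftrightarrow> (\<forall>x. laplacian \<omega> \<mu> u x - V x * u x = f x)"

text \<open>Only the values at vertices with \<open>set_dist \<omega> x \<Omega> > 1\<close> are relevant.\<close>

definition Z_tilde :: "('a \<Rightarrow> 'a \<Rightarrow> real) \<Rightarrow> 'a set \<Rightarrow> real \<Rightarrow> 'a \<Rightarrow> real" where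
  "Z_tilde \<omega> \<Omega> \<alpha> x =
     (if \<alpha> = 1 then - ln (real (set_dist \<omega> x \<Omega>))
      else - (real (set_dist \<omega> x \<Omega>) powr (1 - \<alpha>)))"

text \<open>The filter describing \<open>\<rho>(x,\<Omega>) \<rightarrow> +\<infinity>\<close>.\<close>

definition far_from :: "('a \<Rightarrow> 'a \<Rightarrow> real) \<Rightarrow> 'a set \<Rightarrow> 'a filter" where
  "far_from \<omega> \<Omega> = filtercomap (\<lambda>x. set_dist \<omega> x \<Omega>) at_top"

end

theory Submission
  imports Defs
begin

text \<open>
  Two solutions differ by some \<open>w\<close> with \<open>\<Delta>w = Vw\<close>, and the growth condition makes \<open>w\<close> negligible
  against \<open>h(\<rho>)\<close>, where \<open>h(r)\<close> is \<open>ln (1 + r)\<close> or \<open>(1 + r)\<^sup>1\<^sup>-\<^sup>\<alpha>\<close>. The aim is \<open>w \<le> 0\<close>; exchanging the two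
  solutions then gives \<open>w = 0\<close>.

  The reason is a maximum principle (\<open>subsolution_nonpos\<close>). Let \<open>W > 0\<close> satisfy \<open>\<Delta>W \<le> VW\<close> with
  \<open>V > 0\<close>, and let \<open>w\<close> exceed each multiple \<open>\<epsilon>W\<close> only on a finite set. If \<open>w\<close> were positive somewhere,
  then for a small \<open>\<epsilon>\<close> the function \<open>g = w - \<epsilon>W\<close> would have a positive maximum, where \<open>\<Delta>g \<le> 0\<close>.
  But \<open>\<Delta>g \<ge> Vg > 0\<close> there. Here the growth condition confines \<open>w > \<epsilon>W\<close> to a ball around
  \<open>\<Omega>\<close>, and balls are finite by local finiteness (\<open>finite_set_ball\<close>).

  The barrier is \<open>W = h(\<rho>) + K/c\<^sub>0\<close>. An increasing function of \<open>\<rho>\<close> gains at most \<open>h(r+1) - h(r)\<close>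
  along an edge, and only along edges into the next sphere, so \<open>\<Delta>W \<le> \<DD>\<^sub>+ (h(r+1) - h(r))\<close>
  (\<open>laplacian_radial_le\<close>). The profile \<open>h\<close> is chosen such that its increment is at most
  \<open>(1+r)\<^sup>-\<^sup>\<alpha>\<close>, the rate at which \<open>V\<close> may decay (\<open>profile_increment\<close>). If \<open>\<DD>\<^sub>+ \<le> K\<close> everywhere, the
  additive constant \<open>K/c\<^sub>0\<close> therefore absorbs the whole Laplacian: \<open>\<Delta>W \<le> K(1+r)\<^sup>-\<^sup>\<alpha> \<le> V K/c\<^sub>0 \<le> VW\<close>.
\<close>

section \<open>Distance to a finite set\<close>

lemma ex_path_comb_dist:
  assumes "graph_connected \<omega>"
  shows "\<exists>p. path_between \<omega> x p y \<and> length p = Suc (comb_dist \<omega> x y)"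
proof -
  have "\<exists>p. path_between \<omega> x p y"
  proof (cases "x = y")
    case True
    then have "path_between \<omega> x [x] y"
      by (simp add: path_between_def)
    then show ?thesis ..
  next
    case False
    then show ?thesis
      using assms by (auto simp: graph_connected_def)
  qed
  then obtain p where p: "path_between \<omega> x p y"
    by blast
  then have "length p = Suc (length p - 1)"
    by (simp add: path_between_def)
  with p have "\<exists>n p. path_between \<omega> x p y \<and> length p = Suc n"
    by blast
  then show ?thesis
    unfolding comb_dist_def by (rule LeastI_ex)
qed

lemma ex_set_dist_attained:
  assumes "\<Omega> \<noteq> {}"
  obtains z where "z \<in> \<Omega>" "set_dist \<omega> x \<Omega> = comb_dist \<omega> x z"
proof -
  have "Inf (comb_dist \<omega> x ` \<Omega>) \<in> comb_dist \<omega> x ` \<Omega>"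
    using assms by (intro Inf_nat_def1) simp
  then show thesis
    using that by (auto simp: set_dist_def)
qed

lemma set_dist_adjacent_le:
  assumes "graph_connected \<omega>" "\<Omega> \<noteq> {}" "adjacent \<omega> y x"
  shows "set_dist \<omega> y \<Omega> \<le> set_dist \<omega> x \<Omega> + 1"
proof -
  obtain z where z: "z \<in> \<Omega>" "set_dist \<omega> x \<Omega> = comb_dist \<omega> x z"
    using ex_set_dist_attained[OF assms(2)] .
  obtain p where p: "path_between \<omega> x p z" "length p = Suc (comb_dist \<omega> x z)"
    using ex_path_comb_dist[OF assms(1)] by blast
  have "path_between \<omega> y (y # p) z"
    using p(1) assms(3) by (cases p) (auto simp: path_between_def)
  moreover have "length (y # p) = Suc (comb_dist \<omega> x z + 1)"
    using p(2) by simp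
  ultimately have "comb_dist \<omega> y z \<le> comb_dist \<omega> x z + 1"
    unfolding comb_dist_def[of \<omega> y z] by (intro Least_le) blast
  moreover have "set_dist \<omega> y \<Omega> \<le> comb_dist \<omega> y z"
    unfolding set_dist_def using z(1) by (intro cINF_lower) auto
  ultimately show ?thesis
    using z(2) by linarith
qed

lemma finite_path_sources:
  assumes "weighted_graph \<omega> \<mu>" "locally_finite \<omega>"
  shows "finite {x. \<exists>p. path_between \<omega> x p z \<and> length p = Suc n}"
proof (induction n)
  case 0
  have "{x. \<exists>p. path_between \<omega> x p z \<and> length p = Suc 0} \<subseteq> {z}"
    by (auto simp: path_between_def length_Suc_conv)
  then show ?case
    using finite_subset by blast
next
  case (Suc n)
  let ?B = "{x. \<exists>p. path_between \<omega> x p z \<and> length p = Suc n}"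
  have sym: "adjacent \<omega> y x" if "adjacent \<omega> x y" for x y
    using that weighted_graph.weight_sym[OF assms(1), of x y] by (simp add: adjacent_def)
  have "{x. \<exists>p. path_between \<omega> x p z \<and> length p = Suc (Suc n)}
          \<subseteq> (\<Union>y\<in>?B. {x. adjacent \<omega> y x})"
  proof
    fix x
    assume "x \<in> {x. \<exists>p. path_between \<omega> x p z \<and> length p = Suc (Suc n)}"
    then obtain p where p: "path_between \<omega> x p z" "length p = Suc (Suc n)"
      by blast
    then obtain y q where q: "p = x # y # q"
      by (auto simp: path_between_def length_Suc_conv)
    have "path_between \<omega> y (y # q) z" "length (y # q) = Suc n" "adjacent \<omega> x y"
      using p q by (auto simp: path_between_def)
    then show "x \<in> (\<Union>y\<in>?B. {x. adjacent \<omega> y x})"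
      using sym by blast
  qed
  moreover have "finite (\<Union>y\<in>?B. {x. adjacent \<omega> y x})"
    using Suc.IH assms(2) by (auto simp: locally_finite_def)
  ultimately show ?case
    using finite_subset by blast
qed

lemma finite_set_ball:
  assumes "weighted_graph \<omega> \<mu>" "graph_connected \<omega>" "locally_finite \<omega>"
    and "\<Omega> \<noteq> {}" "finite \<Omega>"
  shows "finite {x. set_dist \<omega> x \<Omega> \<le> n}"
proof (rule finite_subset)
  show "{x. set_dist \<omega> x \<Omega> \<le> n}
          \<subseteq> (\<Union>z\<in>\<Omega>. \<Union>k\<le>n. {x. \<exists>p. path_between \<omega> x p z \<and> length p = Suc k})"
  proof
    fix x
    assume "x \<in> {x. set_dist \<omega> x \<Omega> \<le> n}"
    moreover obtain z where z: "z \<in> \<Omega>" "set_dist \<omega> x \<Omega> = comb_dist \<omega> x z"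
      using ex_set_dist_attained[OF assms(4)] .
    moreover have "\<exists>p. path_between \<omega> x p z \<and> length p = Suc (comb_dist \<omega> x z)"
      by (rule ex_path_comb_dist[OF assms(2)])
    ultimately show
      "x \<in> (\<Union>z\<in>\<Omega>. \<Union>k\<le>n. {x. \<exists>p. path_between \<omega> x p z \<and> length p = Suc k})"
      by auto
  qed
  show "finite (\<Union>z\<in>\<Omega>. \<Union>k\<le>n. {x. \<exists>p. path_between \<omega> x p z \<and> length p = Suc k})"
    using assms(5) finite_path_sources[OF assms(1,3)] by simp
qed

section \<open>The Laplacian on a locally finite graph\<close>

lemma infsum_weight_eq_sum_neighbours:
  assumes "weighted_graph \<omega> \<mu>" "locally_finite \<omega>"
  shows "(\<Sum>\<^sub>\<infinity>y\<in>A. g y * \<omega> x y) = (\<Sum>y\<in>A \<inter> {y. adjacent \<omega> x y}. g y * \<omega> x y)"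
proof -
  have "\<omega> x y = 0" if "\<not> adjacent \<omega> x y" for y
    using that weighted_graph.weight_nonneg[OF assms(1), of x y] by (simp add: adjacent_def)
  then have "(\<Sum>\<^sub>\<infinity>y\<in>A. g y * \<omega> x y) = (\<Sum>\<^sub>\<infinity>y\<in>A \<inter> {y. adjacent \<omega> x y}. g y * \<omega> x y)"
    by (intro infsum_cong_neutral) auto
  then show ?thesis
    using assms(2) by (simp add: locally_finite_def)
qed

lemma laplacian_eq_sum:
  assumes "weighted_graph \<omega> \<mu>" "locally_finite \<omega>"
  shows "laplacian \<omega> \<mu> u x = 1 / \<mu> x * (\<Sum>y | adjacent \<omega> x y. (u y - u x) * \<omega> x y)"
  using infsum_weight_eq_sum_neighbours[OF assms, of "\<lambda>y. u y - u x" x UNIV]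
  by (simp add: laplacian_def)

lemma laplacian_diff_scaled:
  assumes "weighted_graph \<omega> \<mu>" "locally_finite \<omega>"
  shows "laplacian \<omega> \<mu> (\<lambda>y. u y - c * v y) x = laplacian \<omega> \<mu> u x - c * laplacian \<omega> \<mu> v x"
proof -
  have "(\<Sum>y | adjacent \<omega> x y. (u y - c * v y - (u x - c * v x)) * \<omega> x y)
      = (\<Sum>y | adjacent \<omega> x y. (u y - u x) * \<omega> x y)
        - c * (\<Sum>y | adjacent \<omega> x y. (v y - v x) * \<omega> x y)"
    by (simp add: sum_distrib_left sum_subtractf algebra_simps sum.distrib)
  then show ?thesis
    unfolding laplacian_eq_sum[OF assms] by (simp add: right_diff_distrib)
qed

lemma laplacian_add_const: "laplacian \<omega> \<mu> (\<lambda>y. u y + c) x = laplacian \<omega> \<mu> u x"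
  by (simp add: laplacian_def)

lemma laplacian_nonpos_at_max:
  assumes "weighted_graph \<omega> \<mu>" "locally_finite \<omega>" and "\<And>y. g y \<le> g x"
  shows "laplacian \<omega> \<mu> g x \<le> 0"
proof -
  have "(\<Sum>y | adjacent \<omega> x y. (g y - g x) * \<omega> x y) \<le> 0"
    using assms(3) weighted_graph.weight_nonneg[OF assms(1)]
    by (intro sum_nonpos mult_nonpos_nonneg) auto
  then show ?thesis
    using weighted_graph.measure_pos[OF assms(1), of x]
    unfolding laplacian_eq_sum[OF assms(1,2)] by (intro mult_nonneg_nonpos) auto
qed

text \<open>
  A neighbour of \<open>x\<close> lies at most one sphere further out than \<open>x\<close>. Neighbours in the next sphere
  contribute the increment of \<open>h\<close>, and their total weight divided by \<open>\<mu> x\<close> is the outer degree; by monotonicity all the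
  others contribute at most \<open>0\<close>.
\<close>

lemma laplacian_radial_le:
  fixes x :: 'a
  assumes "weighted_graph \<omega> \<mu>" "graph_connected \<omega>" "locally_finite \<omega>" "\<Omega> \<noteq> {}"
    and "mono h"
  defines "r \<equiv> set_dist \<omega> x \<Omega>"
  shows "laplacian \<omega> \<mu> (\<lambda>y. h (set_dist \<omega> y \<Omega>)) x
           \<le> outer_degree \<omega> \<mu> \<Omega> x * (h (r + 1) - h r)"
proof -
  let ?N = "{y. adjacent \<omega> x y}"
  let ?S = "set_sphere \<omega> (r + 1) \<Omega>"
  have fin: "finite ?N"
    using assms(3) by (simp add: locally_finite_def)
  have le: "(h (set_dist \<omega> y \<Omega>) - h r) * \<omega> x y
              \<le> (if y \<in> ?S then (h (r + 1) - h r) * \<omega> x y else 0)" if "y \<in> ?N" for y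
  proof (cases "y \<in> ?S")
    case True
    then show ?thesis
      by (simp add: set_sphere_def)
  next
    case False
    have "adjacent \<omega> y x"
      using that weighted_graph.weight_sym[OF assms(1), of x y] by (simp add: adjacent_def)
    then have "set_dist \<omega> y \<Omega> \<le> r + 1"
      unfolding r_def by (rule set_dist_adjacent_le[OF assms(2,4)])
    with False have "set_dist \<omega> y \<Omega> \<le> r"
      by (simp add: set_sphere_def)
    then have "h (set_dist \<omega> y \<Omega>) - h r \<le> 0"
      using assms(5) by (simp add: monoD)
    then show ?thesis
      using False weighted_graph.weight_nonneg[OF assms(1), of x y]
      by (simp add: mult_nonpos_nonneg)
  qed
  have "(\<Sum>y\<in>?N. (h (set_dist \<omega> y \<Omega>) - h r) * \<omega> x y)
      \<le> (\<Sum>y\<in>?N. if y \<in> ?S then (h (r + 1) - h r) * \<omega> x y else 0)"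
    by (rule sum_mono) (rule le)
  also have "\<dots> = (h (r + 1) - h r) * (\<Sum>y\<in>?S \<inter> ?N. \<omega> x y)"
    using fin by (simp add: sum.inter_restrict[symmetric] Int_commute sum_distrib_left)
  also have "(\<Sum>y\<in>?S \<inter> ?N. \<omega> x y) = (\<Sum>\<^sub>\<infinity>y\<in>?S. \<omega> x y)"
    using infsum_weight_eq_sum_neighbours[OF assms(1,3), of "\<lambda>_. 1" x ?S] by simp
  finally show ?thesis
    using weighted_graph.measure_pos[OF assms(1), of x]
    unfolding laplacian_eq_sum[OF assms(1,3)] outer_degree_def r_def
    by (simp add: divide_right_mono mult.commute)
qed

section \<open>Maximum principle\<close>

lemma subsolution_nonpos:
  assumes graph: "weighted_graph \<omega> \<mu>" "locally_finite \<omega>"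
    and V: "\<And>x. V x > 0"
    and W: "\<And>x. W x > 0" "\<And>x. laplacian \<omega> \<mu> W x \<le> V x * W x"
    and w: "\<And>x. laplacian \<omega> \<mu> w x \<ge> V x * w x"
    and small: "\<And>\<epsilon>. \<epsilon> > 0 \<Longrightarrow> finite {x. w x > \<epsilon> * W x}"
  shows "w x \<le> 0"
proof (rule ccontr)
  assume "\<not> w x \<le> 0"
  then have pos: "w x > 0"
    by simp
  \<comment> \<open>Half of the ratio at \<open>x\<close>, so that \<open>w - \<epsilon>W\<close> is still positive at \<open>x\<close>.\<close>
  define \<epsilon> where "\<epsilon> = w x / (2 * W x)"
  have \<epsilon>: "\<epsilon> > 0"
    using pos W(1)[of x] by (simp add: \<epsilon>_def)
  define g where "g = (\<lambda>y. w y - \<epsilon> * W y)"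
  define P where "P = {y. g y > 0}"
  have "g x > 0"
    using pos W(1)[of x] by (simp add: g_def \<epsilon>_def)
  then have "P \<noteq> {}"
    by (auto simp: P_def)
  moreover have "finite P"
    using small[OF \<epsilon>] by (simp add: P_def g_def)
  ultimately have "Max (g ` P) \<in> g ` P"
    by (intro Max_in) auto
  then obtain m where "m \<in> P" "g m = Max (g ` P)"
    by auto
  with \<open>finite P\<close> have m: "m \<in> P" "\<And>y. y \<in> P \<Longrightarrow> g y \<le> g m"
    by auto
  have gm: "g m > 0"
    using m(1) by (simp add: P_def)
  have "g y \<le> g m" for y
    using m(2)[of y] gm by (cases "y \<in> P") (auto simp: P_def)
  then have "laplacian \<omega> \<mu> g m \<le> 0"
    by (rule laplacian_nonpos_at_max[OF graph])
  moreover have "laplacian \<omega> \<mu> g m = laplacian \<omega> \<mu> w m - \<epsilon> * laplacian \<omega> \<mu> W m"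
    unfolding g_def by (rule laplacian_diff_scaled[OF graph])
  moreover have "\<epsilon> * laplacian \<omega> \<mu> W m \<le> \<epsilon> * (V m * W m)"
    using W(2) \<epsilon> by simp
  moreover have "V m * w m - \<epsilon> * (V m * W m) = V m * g m"
    by (simp add: g_def algebra_simps)
  moreover have "V m * g m > 0"
    using V gm by simp
  ultimately show False
    using w[of m] by linarith
qed

section \<open>The radial barrier\<close>

text \<open>
  The shift by one, compared with \<open>Z_tilde\<close>, matches the factor \<open>(1 + \<rho>)\<^sup>-\<^sup>\<alpha>\<close> in the bound on
  \<open>V\<close>: it makes the increment bound below hold with constant \<open>1\<close> at every radius, including \<open>0\<close>.
\<close>

definition profile :: "real \<Rightarrow> nat \<Rightarrow> real" where
  "profile \<alpha> r = (if \<alpha> = 1 then ln (1 + real r) else (1 + real r) powr (1 - \<alpha>))"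

lemma profile_nonneg: "profile \<alpha> r \<ge> 0"
  by (simp add: profile_def)

lemma mono_profile: "\<alpha> \<le> 1 \<Longrightarrow> mono (profile \<alpha>)"
  by (auto simp: mono_def profile_def intro!: powr_mono2)

text \<open>
  With \<open>s = 1 + r\<close>, Bernoulli's inequality \<open>(1 + 1/s)\<^sup>b \<le> 1 + 1/s\<close> for \<open>b = 1 - \<alpha> \<le> 1\<close> bounds the
  increment of \<open>s\<^sup>b\<close> by \<open>s\<^sup>b\<^sup>-\<^sup>1\<close>.
\<close>

lemma profile_increment:
  assumes "0 \<le> \<alpha>"
  shows "profile \<alpha> (r + 1) - profile \<alpha> r \<le> (1 + real r) powr (- \<alpha>)"
proof -
  define s where "s = 1 + real r"
  have s: "s > 0"
    by (simp add: s_def)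
  have split: "1 + real (r + 1) = s * (1 + 1 / s)"
    using s by (simp add: s_def field_simps)
  show ?thesis
  proof (cases "\<alpha> = 1")
    case True
    have "ln (s * (1 + 1 / s)) = ln s + ln (1 + 1 / s)"
      using s by (simp add: ln_mult_pos add_pos_pos)
    moreover have "ln (1 + 1 / s) \<le> 1 / s"
      using s by (intro ln_add_one_self_le_self) simp
    moreover have "s powr (- \<alpha>) = 1 / s"
      using True s by (simp add: powr_minus_divide)
    ultimately show ?thesis
      using True unfolding profile_def split s_def[symmetric] by simp
  next
    case False
    have "(s * (1 + 1 / s)) powr (1 - \<alpha>) = s powr (1 - \<alpha>) * (1 + 1 / s) powr (1 - \<alpha>)"
      by (rule powr_mult)
    also have "(1 + 1 / s) powr (1 - \<alpha>) \<le> (1 + 1 / s) powr 1"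
      using assms s by (intro powr_mono) auto
    also have "(1 + 1 / s) powr 1 = 1 + 1 / s"
      using s by (simp add: add_pos_pos)
    also have "s powr (1 - \<alpha>) * (1 + 1 / s) = s powr (1 - \<alpha>) + s powr (1 - \<alpha>) / s powr 1"
      using s by (simp add: algebra_simps)
    also have "s powr (1 - \<alpha>) / s powr 1 = s powr (- \<alpha>)"
      using powr_diff[of s "1 - \<alpha>" 1] by simp
    finally show ?thesis
      using False s unfolding profile_def split s_def[symmetric] by simp
  qed
qed

lemma abs_Z_tilde_le_profile:
  assumes "\<alpha> \<le> 1" "set_dist \<omega> x \<Omega> \<ge> 1"
  shows "\<bar>Z_tilde \<omega> \<Omega> \<alpha> x\<bar> \<le> profile \<alpha> (set_dist \<omega> x \<Omega>)"
  using assms by (auto simp: Z_tilde_def profile_def intro!: powr_mono2)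

lemma Z_tilde_nonzero:
  assumes "set_dist \<omega> x \<Omega> \<ge> 2"
  shows "Z_tilde \<omega> \<Omega> \<alpha> x \<noteq> 0"
  using assms by (auto simp: Z_tilde_def)

lemma growth_imp_eventually_le:
  assumes "\<alpha> \<le> 1" "((\<lambda>x. w x / Z_tilde \<omega> \<Omega> \<alpha> x) \<longlongrightarrow> 0) (far_from \<omega> \<Omega>)" "\<epsilon> > 0"
  shows "\<exists>n. \<forall>x. set_dist \<omega> x \<Omega> \<ge> n \<longrightarrow> w x \<le> \<epsilon> * profile \<alpha> (set_dist \<omega> x \<Omega>)"
proof -
  have "eventually (\<lambda>x. \<bar>w x / Z_tilde \<omega> \<Omega> \<alpha> x\<bar> < \<epsilon>) (far_from \<omega> \<Omega>)"
    using tendstoD[OF assms(2,3)] by (simp add: dist_real_def)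
  then obtain n where n: "\<And>x. set_dist \<omega> x \<Omega> \<ge> n \<Longrightarrow> \<bar>w x / Z_tilde \<omega> \<Omega> \<alpha> x\<bar> < \<epsilon>"
    unfolding far_from_def eventually_filtercomap_at_top_linorder by blast
  have "w x \<le> \<epsilon> * profile \<alpha> (set_dist \<omega> x \<Omega>)" if "set_dist \<omega> x \<Omega> \<ge> max n 2" for x
  proof -
    \<comment> \<open>Radius at least \<open>2\<close>: in radius \<open>1\<close> the logarithmic \<open>Z_tilde\<close> vanishes, and the quotient
       would say nothing about \<open>w x\<close>.\<close>
    have "\<bar>Z_tilde \<omega> \<Omega> \<alpha> x\<bar> > 0"
      using Z_tilde_nonzero[of \<omega> x \<Omega> \<alpha>] that by simp
    then have "\<bar>w x\<bar> < \<epsilon> * \<bar>Z_tilde \<omega> \<Omega> \<alpha> x\<bar>"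
      using n[of x] that by (simp add: abs_divide pos_divide_less_eq)
    also have "\<dots> \<le> \<epsilon> * profile \<alpha> (set_dist \<omega> x \<Omega>)"
      using abs_Z_tilde_le_profile[OF assms(1), of \<omega> x \<Omega>] that assms(3) by simp
    finally show ?thesis
      by simp
  qed
  then show ?thesis
    by blast
qed

section \<open>Uniqueness\<close>


theorem corollary3p5:
  fixes \<omega> :: "'a \<Rightarrow> 'a \<Rightarrow> real" and \<mu> :: "'a \<Rightarrow> real" and \<Omega> :: "'a set"
    and f V :: "'a \<Rightarrow> real" and k0 c0 \<alpha> :: real
  assumes "weighted_graph \<omega> \<mu>" and "graph_connected \<omega>" and "locally_finite \<omega>"
    and "\<Omega> \<noteq> {}" and "finite \<Omega>"
    and "k0 > 0"
    and "\<And>x. set_dist \<omega> x \<Omega> \<ge> 1 \<Longrightarrow>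
           0 \<le> outer_degree \<omega> \<mu> \<Omega> x \<and> outer_degree \<omega> \<mu> \<Omega> x \<le> k0"
    and "0 \<le> \<alpha>" and "\<alpha> \<le> 1" and "c0 > 0"
    and "\<And>x. V x \<ge> c0 * (1 + real (set_dist \<omega> x \<Omega>)) powr (- \<alpha>)"
  shows "\<exists>\<^sub>\<le>\<^sub>1 u. is_solution \<omega> \<mu> V f u \<and>
           ((\<lambda>x. u x / Z_tilde \<omega> \<Omega> \<alpha> x) \<longlongrightarrow> 0) (far_from \<omega> \<Omega>)"
proof -
  note graph = assms(1-3) and \<Omega> = assms(4,5)
  let ?\<rho> = "\<lambda>x. set_dist \<omega> x \<Omega>"
  have ball: "finite {x. ?\<rho> x \<le> n}" for n
    by (rule finite_set_ball[OF graph \<Omega>])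

  \<comment> \<open>The bound \<open>k0\<close> is only given outside \<open>\<Omega>\<close>; the ball of radius \<open>0\<close> adds finitely many values.\<close>
  define K where "K = Max (insert k0 (outer_degree \<omega> \<mu> \<Omega> ` {x. ?\<rho> x \<le> 0}))"
  have fin: "finite (insert k0 (outer_degree \<omega> \<mu> \<Omega> ` {x. ?\<rho> x \<le> 0}))"
    using ball by blast
  have "k0 \<le> K"
    unfolding K_def using fin by (intro Max_ge) auto
  then have K_pos: "K > 0"
    using assms(6) by linarith
  have K: "outer_degree \<omega> \<mu> \<Omega> x \<le> K" for x
  proof (cases "?\<rho> x \<ge> 1")
    case True
    then show ?thesis
      using assms(7)[of x] \<open>k0 \<le> K\<close> by linarith
  next
    case False
    then show ?thesis
      unfolding K_def using fin by (intro Max_ge) auto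
  qed

  have V_pos: "V x > 0" for x
  proof -
    have "0 < c0 * (1 + real (?\<rho> x)) powr (- \<alpha>)"
      using assms(10) by (intro mult_pos_pos) auto
    also have "\<dots> \<le> V x"
      by (rule assms(11))
    finally show ?thesis .
  qed

  define W where "W = (\<lambda>x. profile \<alpha> (?\<rho> x) + K / c0)"
  have W_pos: "W x > 0" for x
    using profile_nonneg[of \<alpha> "?\<rho> x"] K_pos assms(10) by (simp add: W_def add_nonneg_pos)
  have W_super: "laplacian \<omega> \<mu> W x \<le> V x * W x" for x
  proof -
    let ?d = "profile \<alpha> (?\<rho> x + 1) - profile \<alpha> (?\<rho> x)"
    have d: "?d \<ge> 0"
      using mono_profile[OF assms(9)] by (simp add: monoD)
    have "laplacian \<omega> \<mu> W x \<le> outer_degree \<omega> \<mu> \<Omega> x * ?d"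
      unfolding W_def laplacian_add_const
      by (rule laplacian_radial_le[OF graph \<Omega>(1) mono_profile[OF assms(9)]])
    also have "\<dots> \<le> K * ?d"
      using K d by (intro mult_right_mono)
    also have "\<dots> \<le> K * (1 + real (?\<rho> x)) powr (- \<alpha>)"
      using profile_increment[OF assms(8)] K_pos by (intro mult_left_mono) auto
    also have "\<dots> = c0 * (1 + real (?\<rho> x)) powr (- \<alpha>) * (K / c0)"
      using assms(10) by simp
    also have "\<dots> \<le> V x * (K / c0)"
      using assms(11)[of x] K_pos assms(10) by (intro mult_right_mono) auto
    also have "\<dots> \<le> V x * W x"
      using V_pos[of x] profile_nonneg[of \<alpha> "?\<rho> x"] by (intro mult_left_mono) (auto simp: W_def)
    finally show ?thesis .
  qed

  have le: "u x \<le> v x"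
    if u: "is_solution \<omega> \<mu> V f u" "((\<lambda>x. u x / Z_tilde \<omega> \<Omega> \<alpha> x) \<longlongrightarrow> 0) (far_from \<omega> \<Omega>)"
      and v: "is_solution \<omega> \<mu> V f v" "((\<lambda>x. v x / Z_tilde \<omega> \<Omega> \<alpha> x) \<longlongrightarrow> 0) (far_from \<omega> \<Omega>)"
    for u v x
  proof -
    define w where "w = (\<lambda>x. u x - v x)"
    have "laplacian \<omega> \<mu> w x \<ge> V x * w x" for x
    proof -
      have "laplacian \<omega> \<mu> w x = laplacian \<omega> \<mu> u x - laplacian \<omega> \<mu> v x"
        using laplacian_diff_scaled[OF assms(1,3), of u 1 v x] by (simp add: w_def)
      moreover have "laplacian \<omega> \<mu> u x = f x + V x * u x" "laplacian \<omega> \<mu> v x = f x + V x * v x"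
        using u(1) v(1) by (simp_all add: is_solution_def diff_eq_eq)
      ultimately show ?thesis
        by (simp add: w_def right_diff_distrib)
    qed
    moreover have "finite {x. w x > \<epsilon> * W x}" if \<epsilon>: "\<epsilon> > 0" for \<epsilon>
    proof -
      have growth: "((\<lambda>x. w x / Z_tilde \<omega> \<Omega> \<alpha> x) \<longlongrightarrow> 0) (far_from \<omega> \<Omega>)"
        using tendsto_diff[OF u(2) v(2)] by (simp add: w_def diff_divide_distrib)
      then obtain n where n: "\<And>x. ?\<rho> x \<ge> n \<Longrightarrow> w x \<le> \<epsilon> * profile \<alpha> (?\<rho> x)"
        using growth_imp_eventually_le[OF assms(9) growth \<epsilon>] by blast
      have "w x \<le> \<epsilon> * W x" if "?\<rho> x \<ge> n" for x
      proof -
        have "\<epsilon> * profile \<alpha> (?\<rho> x) \<le> \<epsilon> * W x"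
          using \<epsilon> K_pos assms(10) by (simp add: W_def)
        with n[OF that] show ?thesis
          by linarith
      qed
      then have "{x. w x > \<epsilon> * W x} \<subseteq> {x. ?\<rho> x \<le> n}"
        by (meson Collect_mono leD nat_le_linear)
      then show ?thesis
        using ball finite_subset by blast
    qed
    ultimately have "w x \<le> 0"
      by (intro subsolution_nonpos[OF assms(1,3) V_pos W_pos W_super])
    then show ?thesis
      by (simp add: w_def)
  qed
  show ?thesis
    by (intro Uniq_I ext antisym) (auto intro: le)
qed

end
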